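(* Let $q$ be a power of a prime $p$, let $n\ge 1$ and $0\le k\le n-1$. For each $0\le s<n$, let $R_{s,1}(x),\dots,R_{s,u_s}(x)$ be all the monic polynomials of degree $s$ in $\mathbb{F}_q[x]$ dividing $x^n-1$ (with $u_s=0$ if there are none), and put $\phi_{s,i}(x)=\dfrac{x^n-1}{R_{s,i}(x)}$ for $1\le i\le u_s$. Then an element $\alpha\in\mathbb{F}_{q^n}$ is a $k$-normal element over $\mathbb{F}_q$ if and only if there is a $j$, $1\le j\le u_k$, such that $$\phi_{k,j}(\sigma)\alpha=0,$$ and also $$\phi_{s,i}(\sigma)\alpha\neq 0$$ for each $s$ with $k<s<n$ and each $1\le i\le u_s$.
   Context: For $0\le k\le n-1$, an element $\alpha\in\mathbb{F}_{q^n}$ is called a $k$-normal element over $\mathbb{F}_q$ if $\deg\gcd\big(x^n-1,\ \sum_{i=0}^{n-1}\alpha^{q^i}x^{n-1-i}\big)=k$ (gcd taken in $\mathbb{F}_{q^n}[x]$). The map $\sigma:\mathbb{F}_{q^n}\to\mathbb{F}_{q^n}$, $\sigma(\eta)=\eta^q$, is the Frobenius map, and for $g(x)=\sum_i g_i x^i\in\mathbb{F}_q[x]$ one sets $g(\sigma)\eta=\sum_i g_i\eta^{q^i}$.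
   Formalization: The case α = 0 with k = n−1 is excluded: there the claim fails, since the gcd is x^n−1 of degree n, so 0 is not (n−1)-normal, while the right-hand condition holds (the quotient by x−1 is a monic divisor of degree n−1 and no s has k < s < n). *)

theory Defs
  imports
    "HOL-Library.Cardinality"
    "Subresultants.More_Homomorphisms"
begin

text \<open>
  The class \<open>field_gcd\<close> merely equips the coefficient field with the (trivial) operations that make
  the library's \<open>gcd\<close> available on its polynomials; every field carries such a structure.

  For \<open>\<alpha> = 0\<close> the second argument of the gcd vanishes, so the gcd is \<open>x ^ n - 1\<close>, of degree \<open>n\<close>:
  zero is not \<open>k\<close>-normal for any \<open>k < n\<close>.
\<close>
definition k_normal :: "nat \<Rightarrow> nat \<Rightarrow> nat \<Rightarrow> 'a::field_gcd \<Rightarrow> bool" where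
  "k_normal q n k \<alpha> \<longleftrightarrow>
     degree (gcd (monom 1 n - 1) (\<Sum>i = 0..n - 1. monom (\<alpha> ^ (q ^ i)) (n - 1 - i))) = k"

text \<open>
  An extension of finite fields is given by a field homomorphism \<open>\<iota>\<close> from the field with \<open>q\<close>
  elements into the larger field, so that the polynomial ring over the small field is a library
  polynomial type of its own. Then \<open>frob_apply \<iota> q g \<eta>\<close> is \<open>g(\<sigma>)\<eta>\<close>, where \<open>\<sigma>\<close> is the
  Frobenius map \<open>\<eta> \<mapsto> \<eta> ^ q\<close>, whose \<open>i\<close>-th iterate is \<open>\<eta> \<mapsto> \<eta> ^ (q ^ i)\<close>.
\<close>
definition frob_apply :: "('k::field \<Rightarrow> 'a::field) \<Rightarrow> nat \<Rightarrow> 'k poly \<Rightarrow> 'a \<Rightarrow> 'a" where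
  "frob_apply \<iota> q g \<eta> = (\<Sum>i\<le>degree g. \<iota> (coeff g i) * \<eta> ^ (q ^ i))"

definition monic_divisors :: "nat \<Rightarrow> nat \<Rightarrow> 'k::field poly set" where
  "monic_divisors n s = {R. monic R \<and> degree R = s \<and> R dvd monom 1 n - 1}"

end

theory Submission
  imports Defs
begin

text \<open>
  Write \<open>f = x ^ n - 1\<close> and \<open>g \<beta> = \<Sum>i<n. \<beta> ^ (q ^ i) x ^ (n - 1 - i)\<close>. Modulo \<open>f\<close>, multiplication of
  \<open>g \<beta>\<close> by \<open>x\<close> yields \<open>g (\<sigma> \<beta>)\<close>, hence multiplication by \<open>h\<close> yields \<open>g (h(\<sigma>) \<beta>)\<close> for every \<open>h\<close> over
  the small field. On the other hand \<open>g (\<sigma> \<alpha>)\<close> arises from \<open>g \<alpha>\<close> by applying \<open>\<sigma>\<close> to the coefficients,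
  so \<open>gcd f (g \<alpha>)\<close> is invariant under \<open>\<sigma>\<close> and comes from a monic divisor \<open>D\<close> of \<open>f\<close> over the small
  field. Thus \<open>h(\<sigma>) \<alpha> = 0\<close> iff \<open>f\<close> divides \<open>h D\<close>, and for \<open>h = f / R\<close> this says that \<open>R\<close>
  divides \<open>D\<close>. The theorem then expresses that \<open>D\<close> has degree \<open>k\<close> by means of the degrees of its
  divisors.
\<close>

section \<open>The polynomial x^n - 1 and its monic divisors\<close>

lemma coeff_xn_minus_1:
  "coeff (monom 1 n - 1 :: 'b::comm_ring_1 poly) j = (if j = n then 1 else 0) - (if j = 0 then 1 else 0)"
  by (auto simp: coeff_monom)

lemma degree_xn_minus_1:
  assumes "n \<ge> 1" shows "degree (monom 1 n - 1 :: 'b::comm_ring_1 poly) = n"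
proof (rule antisym)
  show "degree (monom 1 n - 1 :: 'b poly) \<le> n"
    using assms by (intro degree_le) (auto simp: coeff_xn_minus_1)
  show "n \<le> degree (monom 1 n - 1 :: 'b poly)"
    using assms by (intro le_degree) (auto simp: coeff_xn_minus_1)
qed

lemma monic_xn_minus_1:
  assumes "n \<ge> 1" shows "monic (monom 1 n - 1 :: 'b::comm_ring_1 poly)"
  using assms by (simp add: degree_xn_minus_1 coeff_xn_minus_1)

lemma xn_minus_1_nonzero:
  assumes "n \<ge> 1" shows "(monom 1 n - 1 :: 'b::comm_ring_1 poly) \<noteq> 0"
  using monic_xn_minus_1[OF assms, where 'b='b] by (metis coeff_0 zero_neq_one)

lemma monic_dvd_imp_eq:
  fixes a b :: "'b::field poly"
  assumes "a dvd b" "monic a" "monic b" "degree a = degree b"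
  shows "a = b"
proof -
  from assms(1) obtain c where c: "b = a * c" by (auto simp: dvd_def)
  have "a \<noteq> 0" "c \<noteq> 0" using assms(3) c by auto
  with assms(4) c have "degree c = 0" by (simp add: degree_mult_eq)
  then obtain e where e: "c = [:e:]" by (metis degree_eq_zeroE)
  have "lead_coeff c = 1" using assms(2,3) by (simp add: c lead_coeff_mult)
  with e c show ?thesis by (simp add: one_pCons[symmetric])
qed

text \<open>The cofactor of x - 1 is such a divisor. It settles the case \<alpha> = 0 of the
  theorem.\<close>

lemma exists_monic_divisor_degree_pred:
  assumes "n \<ge> 1"
  shows "\<exists>P :: 'b::field poly. P \<in> monic_divisors n (n - 1)"
proof -
  have "[:-1, 1:] dvd (monom 1 n - 1 :: 'b poly)"
    using poly_eq_0_iff_dvd[of "monom 1 n - 1 :: 'b poly" 1] by (simp add: poly_monom)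
  then obtain P :: "'b poly" where P: "monom 1 n - 1 = [:-1, 1:] * P" by (auto simp: dvd_def)
  have "P \<noteq> 0" using P xn_minus_1_nonzero[OF assms, where 'b='b] by auto
  have "degree ([:-1, 1:] * P) = 1 + degree P" using \<open>P \<noteq> 0\<close> by (subst degree_mult_eq) auto
  then have "degree P = n - 1"
    using degree_xn_minus_1[OF assms, where 'b='b] P by simp
  moreover have "lead_coeff P = 1"
    using monic_xn_minus_1[OF assms, where 'b='b] unfolding P lead_coeff_mult by simp
  ultimately show ?thesis unfolding monic_divisors_def using P by (metis (mono_tags, lifting) dvd_triv_right mem_Collect_eq)
qed

section \<open>Characteristic and Frobenius map\<close>

text \<open>Translation by 1 permutes the field; comparing the sums over all elements shows that the
  cardinality vanishes in the field, so the characteristic divides \<open>p ^ e\<close>.\<close>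

lemma CHAR_eq_if_CARD_prime_power:
  assumes "prime p" and "CARD('a::finite_field) = p ^ e"
  shows "CHAR('a) = p"
proof -
  have "(\<Sum>x\<in>UNIV. x + 1 :: 'a) = (\<Sum>x\<in>UNIV. x)"
    by (rule sum.reindex_bij_betw) (rule bij_betwI[of _ _ _ "\<lambda>x. x - 1"], auto)
  then have "of_nat CARD('a) = (0 :: 'a)" by (simp add: sum.distrib)
  then have "CHAR('a) dvd p ^ e" unfolding assms(2) by (simp only: of_nat_eq_0_iff_char_dvd)
  moreover have "prime CHAR('a)" by (rule prime_CHAR_semidom) simp
  ultimately show ?thesis using assms(1) primes_dvd_imp_eq prime_dvd_power by blast
qed

text \<open>The assumption \<open>q_CHAR_power\<close> is what makes the map \<open>x ^ q\<close>
  additive.\<close>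

locale finite_field_extension = field_hom \<iota>
  for \<iota> :: "'k::finite_field \<Rightarrow> 'a::{finite_field, field_gcd}" +
  fixes q n :: nat
  assumes card_base: "CARD('k) = q"
    and card_ext: "CARD('a) = q ^ n"
    and n_pos: "n \<ge> 1"
    and q_CHAR_power: "\<exists>m. q = CHAR('a) ^ m"
begin

interpretation \<iota>: map_poly_inj_idom_hom \<iota> ..

lemma q_gt_1: "q > 1"
proof -
  have "card {0, 1 :: 'k} \<le> CARD('k)" by (intro card_mono) auto
  then show ?thesis using card_base by simp
qed

lemma frob_hom: "field_hom (\<lambda>x :: 'a. x ^ q)"
proof
  fix x y :: 'a
  obtain m where "q = CHAR('a) ^ m" using q_CHAR_power by blast
  then show "(x + y) ^ q = x ^ q + y ^ q"
    by (intro freshmans_dream') (auto intro: prime_CHAR_semidom)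
qed (use q_gt_1 in \<open>auto simp: power_mult_distrib\<close>)

interpretation frob: field_hom "\<lambda>x :: 'a. x ^ q" by (rule frob_hom)
interpretation frob_poly: map_poly_inj_idom_hom "\<lambda>x :: 'a. x ^ q" ..

lemma frob_iota: "\<iota> c ^ q = \<iota> c"
  using finite_field_power_card_eq_same[of c] card_base by (simp flip: hom_power)

lemma frob_iota_iter: "\<iota> c ^ (q ^ i) = \<iota> c"
  by (induction i) (simp_all add: frob_iota power_mult)

lemma frob_n: "(\<beta> :: 'a) ^ (q ^ n) = \<beta>"
  using finite_field_power_card_eq_same[of \<beta>] card_ext by simp

text \<open>The image of \<open>\<iota>\<close> already supplies q roots of X^q - X, which has at
  most q of them.\<close>

lemma frob_fixed_imp_range:
  assumes "x ^ q = x"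
  shows "x \<in> range \<iota>"
proof -
  define P where "P = monom 1 q - monom (1 :: 'a) 1"
  have "coeff P q = 1" using q_gt_1 by (simp add: P_def coeff_monom)
  then have "P \<noteq> 0" by auto
  have "degree P \<le> q" unfolding P_def using q_gt_1
    by (intro degree_diff_le) (auto intro: order.trans[OF degree_monom_le])
  moreover have "card {y. poly P y = 0} \<le> degree P"
    by (rule card_poly_roots_bound) fact
  moreover have "card (range \<iota>) = q"
    using card_base by (simp add: card_image inj_f)
  moreover have "range \<iota> \<subseteq> {y. poly P y = 0}"
    by (auto simp: P_def poly_monom frob_iota)
  ultimately have "range \<iota> = {y. poly P y = 0}"
    using \<open>P \<noteq> 0\<close> by (intro card_seteq poly_roots_finite) auto
  then show ?thesis using assms by (auto simp: P_def poly_monom)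
qed

lemma frob_fixed_poly_imp_range:
  assumes "map_poly (\<lambda>x. x ^ q) P = P"
  shows "\<exists>D. P = map_poly \<iota> D"
proof
  have "coeff P i ^ q = coeff P i" for i
    by (subst (2) assms[symmetric], subst coeff_map_poly) (use q_gt_1 in auto)
  then have *: "\<iota> (inv_into UNIV \<iota> (coeff P i)) = coeff P i" for i
    by (rule f_inv_into_f[OF frob_fixed_imp_range])
  \<comment> \<open>Mapping coefficients with \<open>map_poly\<close> is faithful only for a
    function that sends 0 to 0.\<close>
  have "inv_into UNIV \<iota> 0 = 0" using inv_f_f[of 0] by (simp only: hom_zero)
  then show "P = map_poly \<iota> (map_poly (inv_into UNIV \<iota>) P)"
    by (intro poly_eqI) (simp add: coeff_map_poly *)
qed

section \<open>The polynomial of conjugates\<close>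

abbreviation f_poly :: "'b::comm_ring_1 poly" where "f_poly \<equiv> monom 1 n - 1"

definition conj_poly :: "'a \<Rightarrow> 'a poly" where
  "conj_poly \<beta> = (\<Sum>i = 0..n - 1. monom (\<beta> ^ (q ^ i)) (n - 1 - i))"

lemma coeff_conj_poly: "coeff (conj_poly \<beta>) j = (if j < n then \<beta> ^ (q ^ (n - 1 - j)) else 0)"
proof -
  have "coeff (conj_poly \<beta>) j = (\<Sum>i = 0..n - 1. if n - 1 - i = j then \<beta> ^ (q ^ i) else 0)"
    by (simp add: conj_poly_def coeff_sum coeff_monom)
  \<comment> \<open>The index equation is solved for i. The guard \<open>j < n\<close> is essential:
    for larger j truncated subtraction would select i = 0.\<close>
  also have "\<dots> = (\<Sum>i = 0..n - 1. if i = n - 1 - j then (if j < n then \<beta> ^ (q ^ i) else 0) else 0)"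
    using n_pos by (intro sum.cong) auto
  also have "\<dots> = (if j < n then \<beta> ^ (q ^ (n - 1 - j)) else 0)"
    by (simp only: sum.delta finite_atLeastAtMost) auto
  finally show ?thesis .
qed

lemma conj_poly_add: "conj_poly (\<beta> + \<gamma>) = conj_poly \<beta> + conj_poly \<gamma>"
proof -
  have "(\<beta> + \<gamma>) ^ (q ^ i) = \<beta> ^ (q ^ i) + \<gamma> ^ (q ^ i)" for i
    by (induction i) (simp_all add: power_mult frob.hom_add mult.commute[of q])
  then show ?thesis by (intro poly_eqI) (simp add: coeff_conj_poly)
qed

lemma conj_poly_iota_mult: "conj_poly (\<iota> c * \<beta>) = Polynomial.smult (\<iota> c) (conj_poly \<beta>)"
  by (intro poly_eqI) (simp add: coeff_conj_poly power_mult_distrib frob_iota_iter)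

lemma map_poly_frob_conj_poly: "map_poly (\<lambda>x. x ^ q) (conj_poly \<beta>) = conj_poly (\<beta> ^ q)"
proof -
  have "(\<beta> ^ q ^ i) ^ q = (\<beta> ^ q) ^ q ^ i" for i by (metis power_mult mult.commute)
  then show ?thesis by (intro poly_eqI) (simp add: coeff_conj_poly)
qed

text \<open>Multiplication by x shifts the conjugates cyclically: the top term \<beta> x^n wraps
  around to the constant term, which is right because \<beta>^(q^n) = \<beta>.\<close>

lemma pCons_conj_poly: "pCons 0 (conj_poly \<beta>) = conj_poly (\<beta> ^ q) + Polynomial.smult \<beta> f_poly"
proof (rule poly_eqI)
  fix j
  have *: "(\<beta> ^ q) ^ q ^ i = \<beta> ^ (q ^ Suc i)" for i by (simp add: power_mult)
  show "coeff (pCons 0 (conj_poly \<beta>)) j = coeff (conj_poly (\<beta> ^ q) + Polynomial.smult \<beta> f_poly) j"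
  proof (cases j)
    case 0
    then show ?thesis
      using n_pos frob_n[of \<beta>] by (simp add: coeff_conj_poly * coeff_xn_minus_1 del: power_Suc)
  next
    case (Suc i)
    then show ?thesis
      using n_pos by (auto simp: coeff_conj_poly * coeff_xn_minus_1 Suc_diff_Suc simp del: power_Suc)
  qed
qed

lemma degree_conj_poly: "degree (conj_poly \<beta>) < n"
  using n_pos by (intro degree_lessI) (auto simp: coeff_conj_poly)

text \<open>The degree is below n, so divisibility forces the zero polynomial, and \<beta> itself is
  the coefficient of x^(n-1).\<close>

lemma f_poly_dvd_conj_poly_iff: "f_poly dvd conj_poly \<beta> \<longleftrightarrow> \<beta> = 0"
proof
  assume dvd: "f_poly dvd conj_poly \<beta>"
  have "conj_poly \<beta> = 0"
    using dvd_imp_degree_le[OF dvd] degree_conj_poly[of \<beta>] degree_xn_minus_1[OF n_pos, where 'b='a]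
    by force
  then have "coeff (conj_poly \<beta>) (n - 1) = 0" by simp
  then show "\<beta> = 0" using n_pos by (simp add: coeff_conj_poly)
next
  assume "\<beta> = 0"
  then have "conj_poly \<beta> = 0"
    using q_gt_1 by (intro poly_eqI) (simp add: coeff_conj_poly power_0_left)
  then show "f_poly dvd conj_poly \<beta>" by simp
qed

section \<open>Polynomials in the Frobenius map\<close>

lemma frob_apply_pCons: "frob_apply \<iota> q (pCons c h) \<beta> = \<iota> c * \<beta> + frob_apply \<iota> q h (\<beta> ^ q)"
proof (cases "h = 0")
  case False
  then have "frob_apply \<iota> q (pCons c h) \<beta>
      = (\<Sum>i\<le>Suc (degree h). \<iota> (coeff (pCons c h) i) * \<beta> ^ (q ^ i))"
    by (simp add: frob_apply_def)
  also have "\<dots> = \<iota> c * \<beta> + frob_apply \<iota> q h (\<beta> ^ q)"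
    by (subst sum.atMost_Suc_shift) (simp add: frob_apply_def power_mult)
  finally show ?thesis .
qed (simp add: frob_apply_def)

text \<open>Horner-style induction: each factor x is absorbed by \<open>pCons_conj_poly\<close>,
  which replaces \<beta> by \<open>\<beta> ^ q\<close>; hence \<beta> is arbitrary.\<close>

lemma f_poly_dvd_mult_conj_poly:
  "f_poly dvd map_poly \<iota> h * conj_poly \<beta> - conj_poly (frob_apply \<iota> q h \<beta>)"
proof (induction h arbitrary: \<beta>)
  case 0
  show ?case using f_poly_dvd_conj_poly_iff[of 0] by (simp add: frob_apply_def)
next
  case (pCons c h)
  have "map_poly \<iota> (pCons c h) * conj_poly \<beta> - conj_poly (frob_apply \<iota> q (pCons c h) \<beta>)
     = map_poly \<iota> h * pCons 0 (conj_poly \<beta>) - conj_poly (frob_apply \<iota> q h (\<beta> ^ q))"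
    by (simp add: frob_apply_pCons conj_poly_add conj_poly_iota_mult hom_distribs)
  also have "\<dots> = (map_poly \<iota> h * conj_poly (\<beta> ^ q) - conj_poly (frob_apply \<iota> q h (\<beta> ^ q)))
      + Polynomial.smult \<beta> (map_poly \<iota> h) * f_poly"
    by (simp only: pCons_conj_poly) (simp add: algebra_simps)
  finally show ?case using pCons.IH[of "\<beta> ^ q"] by (metis dvd_add dvd_triv_right)
qed

lemma frob_apply_eq_0_iff:
  "frob_apply \<iota> q h \<beta> = 0 \<longleftrightarrow> f_poly dvd map_poly \<iota> h * conj_poly \<beta>"
proof -
  have "f_poly dvd map_poly \<iota> h * conj_poly \<beta> \<longleftrightarrow> f_poly dvd conj_poly (frob_apply \<iota> q h \<beta>)"
    using dvd_add_right_iff[OF f_poly_dvd_mult_conj_poly[of h \<beta>], of "conj_poly (frob_apply \<iota> q h \<beta>)"]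
    by (simp only: diff_add_cancel)
  then show ?thesis by (simp add: f_poly_dvd_conj_poly_iff)
qed

section \<open>Descent of the gcd to the small field\<close>

text \<open>The image of d under \<sigma> divides x^n - 1 and
  \<open>conj_poly (\<beta> ^ q)\<close>, hence also x times \<open>conj_poly \<beta>\<close>. As x
  is coprime to x^n - 1, the image divides d, and both are monic of the same degree.\<close>

lemma gcd_f_poly_conj_poly_frob_fixed:
  fixes \<beta>
  defines "d \<equiv> gcd f_poly (conj_poly \<beta>)"
  shows "map_poly (\<lambda>x. x ^ q) d = d"
proof (rule monic_dvd_imp_eq)
  let ?\<sigma> = "map_poly (\<lambda>x :: 'a. x ^ q)"
  have f0: "(f_poly :: 'a poly) \<noteq> 0" by (rule xn_minus_1_nonzero) (rule n_pos)
  show monic: "monic d" unfolding d_def by (rule poly_gcd_monic) (use f0 in blast)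
  then show "monic (?\<sigma> d)" by simp
  show "degree (?\<sigma> d) = degree d" by simp
  have \<sigma>f: "?\<sigma> f_poly = f_poly" by (simp add: hom_distribs)
  have *: "?\<sigma> d dvd f_poly" by (subst \<sigma>f[symmetric], rule frob_poly.hom_dvd) (simp add: d_def)
  have "?\<sigma> d dvd conj_poly (\<beta> ^ q)"
    by (subst map_poly_frob_conj_poly[symmetric], rule frob_poly.hom_dvd) (simp add: d_def)
  with * have dvd: "?\<sigma> d dvd monom 1 1 * conj_poly \<beta>"
    using pCons_conj_poly[of \<beta>] by (simp add: monom_Suc dvd_smult)
  have "coprime f_poly (monom (1::'a) 1)"
  proof (rule coprimeI)
    fix c :: "'a poly"
    assume c: "c dvd f_poly" "c dvd monom 1 1"
    have "monom (1::'a) n = monom 1 1 * monom 1 (n - 1)"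
      using n_pos by (simp add: mult_monom)
    then have "c dvd monom 1 n" using c(2) by (simp add: dvd_mult2)
    from dvd_diff_right_iff[OF this] c(1) show "is_unit c" by blast
  qed
  from coprime_divisors[OF * dvd_refl this] have "coprime (?\<sigma> d) (monom 1 1)" .
  with dvd have "?\<sigma> d dvd conj_poly \<beta>" by (simp add: coprime_dvd_mult_right_iff)
  with * show "?\<sigma> d dvd d" by (simp add: d_def)
qed

lemma k_normal_altdef: "k_normal q n k \<alpha> \<longleftrightarrow> degree (gcd f_poly (conj_poly \<alpha>)) = k"
  by (simp add: k_normal_def conj_poly_def)

text \<open>\<open>D\<close> is the descended gcd. The last two facts separate \<alpha> = 0, where
  \<open>D\<close> has degree n and so lies outside the range s < n of the theorem.\<close>

lemma obtain_annihilator_divisor: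
  obtains D :: "'k poly"
  where "monic D" "D dvd f_poly" "\<And>k. k_normal q n k \<alpha> \<longleftrightarrow> degree D = k"
    and "\<And>R. R dvd f_poly \<Longrightarrow> frob_apply \<iota> q (f_poly div R) \<alpha> = 0 \<longleftrightarrow> R dvd D"
    and "\<alpha> \<noteq> 0 \<Longrightarrow> degree D < n" "\<alpha> = 0 \<Longrightarrow> D = f_poly"
proof -
  define d where "d = gcd f_poly (conj_poly \<alpha>)"
  obtain D where D: "d = map_poly \<iota> D"
    using frob_fixed_poly_imp_range[OF gcd_f_poly_conj_poly_frob_fixed, of \<alpha>] d_def by blast
  have f0: "(f_poly :: 'a poly) \<noteq> 0" "(f_poly :: 'k poly) \<noteq> 0"
    using xn_minus_1_nonzero[OF n_pos] by auto
  have \<iota>f: "map_poly \<iota> f_poly = f_poly" by (simp add: hom_distribs)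
  have "monic d" unfolding d_def by (rule poly_gcd_monic) (use f0 in blast)
  then have monic: "monic D" by (simp add: D)
  have dvd: "D dvd f_poly"
  proof -
    have "map_poly \<iota> D dvd map_poly \<iota> f_poly" unfolding \<iota>f D[symmetric] by (simp add: d_def)
    then show ?thesis by (rule dvd_map_poly_hom_imp_dvd)
  qed
  have degree: "degree D < n" if "\<alpha> \<noteq> 0"
  proof -
    have "conj_poly \<alpha> \<noteq> 0" using f_poly_dvd_conj_poly_iff[of \<alpha>] that by auto
    then have "degree d \<le> degree (conj_poly \<alpha>)" by (intro dvd_imp_degree_le) (simp_all add: d_def)
    then show ?thesis using degree_conj_poly[of \<alpha>] by (simp add: D)
  qed
  have zero: "D = f_poly" if "\<alpha> = 0"
  proof (rule monic_dvd_imp_eq[OF dvd monic monic_xn_minus_1[OF n_pos]])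
    have "f_poly dvd d" using that f_poly_dvd_conj_poly_iff[of \<alpha>] by (simp add: d_def)
    then have "map_poly \<iota> f_poly dvd map_poly \<iota> D" by (simp add: \<iota>f D)
    then have "f_poly dvd D" by (rule dvd_map_poly_hom_imp_dvd)
    then show "degree D = degree (f_poly :: 'k poly)"
      using dvd f0 by (intro antisym dvd_imp_degree_le) auto
  qed
  have annihil: "frob_apply \<iota> q (f_poly div R) \<alpha> = 0 \<longleftrightarrow> R dvd D" if "R dvd f_poly" for R
  proof -
    from that obtain S where S: "f_poly = R * S" by (auto simp: dvd_def)
    have "R \<noteq> 0" "S \<noteq> 0" using S f0 by auto
    have div: "f_poly div R = S" using \<open>R \<noteq> 0\<close> by (simp add: S)
    let ?s = "map_poly \<iota> S"
    \<comment> \<open>The first argument is a multiple of \<open>f_poly\<close> and imposes no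
      condition; it is inserted so that \<open>?s\<close> can be pulled out of the gcd, leaving
      d.\<close>
    have "frob_apply \<iota> q S \<alpha> = 0 \<longleftrightarrow> f_poly dvd gcd (?s * f_poly) (?s * conj_poly \<alpha>)"
      by (simp add: frob_apply_eq_0_iff)
    also have "\<dots> \<longleftrightarrow> f_poly dvd ?s * d"
      by (simp add: gcd_mult_left d_def)
    also have "\<dots> \<longleftrightarrow> map_poly \<iota> f_poly dvd map_poly \<iota> (S * D)"
      by (simp add: \<iota>f D hom_distribs)
    also have "\<dots> \<longleftrightarrow> f_poly dvd S * D"
      using dvd_map_poly_hom_imp_dvd \<iota>.hom_dvd by blast
    also have "\<dots> \<longleftrightarrow> R dvd D" using \<open>S \<noteq> 0\<close> by (simp add: S mult.commute[of R])
    finally show ?thesis by (simp add: div)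
  qed
  have normal: "k_normal q n k \<alpha> \<longleftrightarrow> degree D = k" for k
    unfolding k_normal_altdef d_def[symmetric] D by simp
  show thesis using that[OF monic dvd normal annihil degree zero] by blast
qed

end

section \<open>The degree of \<open>D\<close> read off from its divisors\<close>

text \<open>The last hypothesis excludes \<alpha> = 0 with k = n - 1. There the right-hand side
  holds, since a divisor of degree n - 1 exists and no s satisfies k < s < n, yet zero is not
  k-normal.\<close>

theorem lemma3p1:
  fixes \<iota> :: "'k::finite_field \<Rightarrow> 'a::{finite_field, field_gcd}"
    and p m q n k :: nat
    and u :: "nat \<Rightarrow> nat"
    and R \<phi> :: "nat \<Rightarrow> nat \<Rightarrow> 'k poly"
    and \<alpha> :: 'a
  assumes "prime p" and "m \<ge> 1" and "q = p ^ m"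
    and "field_hom \<iota>" and "CARD('k) = q" and "CARD('a) = q ^ n"
    and "n \<ge> 1" and "k \<le> n - 1"
    and "\<And>s. s < n \<Longrightarrow> bij_betw (R s) {1..u s} (monic_divisors n s)"
    and "\<And>s i. s < n \<Longrightarrow> i \<in> {1..u s} \<Longrightarrow> \<phi> s i = (monom 1 n - 1) div R s i"
    and "\<alpha> \<noteq> 0 \<or> k < n - 1"
  shows "k_normal q n k \<alpha> \<longleftrightarrow>
    (\<exists>j\<in>{1..u k}. frob_apply \<iota> q (\<phi> k j) \<alpha> = 0) \<and>
    (\<forall>s. k < s \<and> s < n \<longrightarrow> (\<forall>i\<in>{1..u s}. frob_apply \<iota> q (\<phi> s i) \<alpha> \<noteq> 0))"
proof -
  have "CHAR('a) = p"
    using assms(1,3,6) by (intro CHAR_eq_if_CARD_prime_power[of p "m * n"]) (auto simp: power_mult)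
  then interpret finite_field_extension \<iota> q n
    using assms(3-7) by (intro finite_field_extension.intro finite_field_extension_axioms.intro) auto
  obtain D :: "'k poly" where D: "monic D" "D dvd f_poly" "\<And>k. k_normal q n k \<alpha> \<longleftrightarrow> degree D = k"
    and annihil: "\<And>R. R dvd f_poly \<Longrightarrow> frob_apply \<iota> q (f_poly div R) \<alpha> = 0 \<longleftrightarrow> R dvd D"
    and degree: "\<alpha> \<noteq> 0 \<Longrightarrow> degree D < n" and zero: "\<alpha> = 0 \<Longrightarrow> D = f_poly"
    using obtain_annihilator_divisor[of \<alpha>] by blast
  have "D \<noteq> 0" using D(1) by (metis coeff_0 zero_neq_one)
  have R: "R s ` {1..u s} = monic_divisors n s" if "s < n" for s
    using assms(9)[OF that] by (simp add: bij_betw_def)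
  have \<phi>: "frob_apply \<iota> q (\<phi> s i) \<alpha> = 0 \<longleftrightarrow> R s i dvd D" if "s < n" "i \<in> {1..u s}" for s i
  proof -
    have "R s i \<in> monic_divisors n s" using R that by blast
    then show ?thesis using assms(10)[OF that] annihil by (simp add: monic_divisors_def)
  qed
  have ex: "(\<exists>i\<in>{1..u s}. frob_apply \<iota> q (\<phi> s i) \<alpha> = 0) \<longleftrightarrow> (\<exists>P\<in>monic_divisors n s. P dvd D)"
    if "s < n" for s
    unfolding R[OF that, symmetric] using \<phi>[OF that] by simp
  have "k < n" using assms(7,8) by simp
  have "degree D = k \<longleftrightarrow> (\<exists>P\<in>monic_divisors n k. P dvd D) \<and>
    (\<forall>s. k < s \<and> s < n \<longrightarrow> \<not> (\<exists>P\<in>monic_divisors n s. P dvd D))" (is "_ \<longleftrightarrow> ?rhs")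
  proof
    assume k: "degree D = k"
    then have "D \<in> monic_divisors n k" using D(1,2) by (simp add: monic_divisors_def)
    moreover have "s \<le> k" if "P \<in> monic_divisors n s" "P dvd D" for P s
      using dvd_imp_degree_le[OF that(2)] that(1) k \<open>D \<noteq> 0\<close> by (auto simp: monic_divisors_def)
    ultimately show ?rhs by (meson dvd_refl leD)
  next
    assume rhs: ?rhs
    \<comment> \<open>If \<alpha> = 0, then \<open>D\<close> is x^n - 1 and has a monic divisor of
      degree n - 1 > k, against the second condition.\<close>
    have "\<alpha> \<noteq> 0"
    proof
      assume "\<alpha> = 0"
      then have k: "k < n - 1" "n - 1 < n" and "D = f_poly" using assms(7,11) zero by auto
      obtain P :: "'k poly" where P: "P \<in> monic_divisors n (n - 1)"
        using exists_monic_divisor_degree_pred[OF assms(7)] by blast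
      then have "P dvd D" by (simp add: monic_divisors_def \<open>D = f_poly\<close>)
      with P k rhs show False by blast
    qed
    then have "degree D < n" by (rule degree)
    \<comment> \<open>\<open>D\<close> divides itself, so the second condition at s =
      \<open>degree D\<close> rules out a degree above k.\<close>
    moreover have "D \<in> monic_divisors n (degree D)" using D(1,2) by (simp add: monic_divisors_def)
    ultimately have "\<not> k < degree D" using rhs dvd_refl[of D] by metis
    moreover obtain P where "P \<in> monic_divisors n k" "P dvd D" using rhs by blast
    then have "k \<le> degree D" using \<open>D \<noteq> 0\<close> dvd_imp_degree_le[of P D] by (auto simp: monic_divisors_def)
    ultimately show "degree D = k" by simp
  qed
  also have "(\<exists>P\<in>monic_divisors n k. P dvd D) \<longleftrightarrow> (\<exists>j\<in>{1..u k}. frob_apply \<iota> q (\<phi> k j) \<alpha> = 0)"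
    using ex[OF \<open>k < n\<close>] by (rule sym)
  also have "(\<forall>s. k < s \<and> s < n \<longrightarrow> \<not> (\<exists>P\<in>monic_divisors n s. P dvd D)) \<longleftrightarrow>
    (\<forall>s. k < s \<and> s < n \<longrightarrow> (\<forall>i\<in>{1..u s}. frob_apply \<iota> q (\<phi> s i) \<alpha> \<noteq> 0))"
    by (intro all_cong) (subst ex[symmetric], simp_all)
  finally show ?thesis unfolding D(3) .
qed

end
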